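(* Let $(\mathbf X,d)$ be a complete length space and $\Omega$ an open set in $\mathbf X$. Assume that $f:\Omega\to\mathbb R$ is locally uniformly continuous and $f\ge0$ in $\Omega$. Let $u\in\mathrm{Lip}_{loc}(\Omega)$. Then: (i) $u$ is a Monge supersolution of $|\nabla u|=f$ in $\Omega$ if and only if $u$ is an s-supersolution of $|\nabla u|=f$ in $\Omega$. (ii) Assume in addition that $f>0$ on $\Omega$. If $u$ is a local c-supersolution of $|\nabla u|=f$ in $\Omega$, then $u$ is a Monge supersolution of $|\nabla u|=f$ in $\Omega$.
   Context: "Locally" means in a sufficiently small open ball around each point of $\Omega$; $B_r(x)$ is the open $d$-ball. $\mathrm{Lip}_{loc}(\Omega)$ is the set of locally Lipschitz functions on $\Omega$. Slopes: $|\nabla u|(x)=\limsup_{y\to x}\frac{|u(y)-u(x)|}{d(x,y)}$, $|\nabla^+u|(x)=\limsup_{y\to x}\frac{\max\{u(y)-u(x),0\}}{d(x,y)}$, $|\nabla^-u|(x)=\limsup_{y\to x}\frac{\max\{u(x)-u(y),0\}}{d(x,y)}$. Monge supersolution: $u\in\mathrm{Lip}_{loc}(\Omega)$ with $|\nabla^-u|(x)\ge f(x)$ for every $x\in\Omega$. s-supersolution: let $\overline{\mathcal C}(\Omega)$ be the set of $\psi\in\mathrm{Lip}_{loc}(\Omega)$ with $|\nabla^+\psi|=|\nabla\psi|$ in $\Omega$ and $|\nabla\psi|$ continuous in $\Omega$, and $|\nabla\psi|^*(x)=\limsup_{y\to x}|\nabla\psi|(y)$. A lower semicontinuous $u:\Omega\to\mathbb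 R$ is an s-supersolution of $|\nabla u|=f$ if $|\nabla\psi_1|(x)\ge f(x)-|\nabla\psi_2|^*(x)$ whenever $\psi_1\in\overline{\mathcal C}(\Omega)$, $\psi_2\in\mathrm{Lip}_{loc}(\Omega)$ and $u-\psi_1-\psi_2$ has a local minimum at $x\in\Omega$. Local c-supersolution: $\mathcal A_x(\mathbb R,\mathbf X)$ is the set of absolutely continuous curves $\xi:\mathbb R\to\mathbf X$ with $|\xi'|\le1$ a.e. (i.e. $1$-Lipschitz) and $\xi(0)=x$. For open $\mathcal O$, $T^+_{\mathcal O}[\xi]=\inf\{t\ge0:\xi(t)\notin\mathcal O\}$, $T^-_{\mathcal O}[\xi]=\sup\{t\le0:\xi(t)\notin\mathcal O\}$ ($\inf\emptyset=+\infty$, $\sup\emptyset=-\infty$). A lower semicontinuous $u:\Omega\to\mathbb R$ is a local c-supersolution of $|\nabla u|=f$ if for each $x\in\Omega$ there is $r>0$ with $B_r(x)\subset\Omega$ such that for each $\varepsilon>0$ there are $\xi_\varepsilon\in\mathcal A_x(\mathbb R,\mathbf X)$ and a lower semicontinuous $w:(t_r^-,t_r^+)\to\mathbb R$, where $t_r^\pm=T^\pm_{B_r(x)}[\xi_\varepsilon]$, with $w(0)=u(x)$, $w(t)\ge u(\xi_\varepsilon(t))-\varepsilon$ for all $t\in(t_r^-,t_r^+)$, and $|\phi'(t_0)|\ge f(\xi_\varepsilon(t_0))-\varepsilon$ whenever $\phi\in C^1(\mathbb R)$ and $w-\phi$ attains a minimum at $t_0\in(t_r^-,t_r^+)$.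
   Formalization: In the definition of local c-supersolution, "w−φ attains a minimum at t0" is taken as a local minimum; with a global minimum over the exit interval part (ii) fails, e.g. Ω=(−1,1), u=ln(1−x²), f=100. *)

theory Defs
  imports "HOL-Analysis.Analysis"
begin

text \<open>
  A function on an open set \<open>\<Omega>\<close> is a total function on the ambient type; since \<open>\<Omega>\<close> is open, the
  notions below depend only on its values on \<open>\<Omega>\<close>.
\<close>

subsection \<open>Length spaces\<close>

text \<open>Supremum of the polygonal sums over all finite increasing sequences of parameters.\<close>
definition curve_length :: "(real \<Rightarrow> 'a::metric_space) \<Rightarrow> ereal" where
  "curve_length \<gamma> =
     (SUP ts \<in> {ts. sorted ts \<and> set ts \<subseteq> {0..1}}.
        ereal (\<Sum>i < length ts - 1. dist (\<gamma> (ts ! i)) (\<gamma> (ts ! Suc i))))"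

text \<open>Curves of infinite length do not affect the infimum; it is \<open>\<infinity>\<close> if there is no curve at all.\<close>
definition length_space :: "'a::metric_space set \<Rightarrow> bool" where
  "length_space X \<longleftrightarrow>
     (\<forall>x\<in>X. \<forall>y\<in>X. ereal (dist x y) =
        (INF \<gamma> \<in> {\<gamma>. path \<gamma> \<and> path_image \<gamma> \<subseteq> X \<and> pathstart \<gamma> = x \<and> pathfinish \<gamma> = y}.
           curve_length \<gamma>))"

subsection \<open>Local regularity of functions\<close>

definition Lip_loc :: "'a::metric_space set \<Rightarrow> ('a \<Rightarrow> real) set" where
  "Lip_loc \<Omega> = {u. \<forall>x\<in>\<Omega>. \<exists>r>0. ball x r \<subseteq> \<Omega> \<and> (\<exists>L. L-lipschitz_on (ball x r) u)}"

definition locally_uniformly_continuous_on :: "'a::metric_space set \<Rightarrow> ('a \<Rightarrow> real) \<Rightarrow> bool" where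
  "locally_uniformly_continuous_on \<Omega> f \<longleftrightarrow>
     (\<forall>x\<in>\<Omega>. \<exists>r>0. ball x r \<subseteq> \<Omega> \<and> uniformly_continuous_on (ball x r) f)"

definition lsc_on :: "'a::topological_space set \<Rightarrow> ('a \<Rightarrow> real) \<Rightarrow> bool" where
  "lsc_on S u \<longleftrightarrow> (\<forall>x\<in>S. ereal (u x) \<le> Liminf (at x within S) (\<lambda>y. ereal (u y)))"

definition local_min_at :: "('a::topological_space \<Rightarrow> real) \<Rightarrow> 'a \<Rightarrow> bool" where
  "local_min_at g x \<longleftrightarrow> (\<forall>\<^sub>F y in nhds x. g x \<le> g y)"

subsection \<open>Slopes\<close>

text \<open>
  The punctured upper limit of a nonnegative function. At an isolated point, which occurs in a
  length space only if the space is a single point, it is \<open>0\<close>, the usual convention for slopes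
  (\<^const>\<open>Limsup\<close> along the trivial filter would be \<open>-\<infinity>\<close>).
\<close>
definition limsup_to :: "'a::t2_space \<Rightarrow> ('a \<Rightarrow> ereal) \<Rightarrow> ereal" where
  "limsup_to x g = (if at x = bot then 0 else Limsup (at x) g)"

definition slope :: "('a::metric_space \<Rightarrow> real) \<Rightarrow> 'a \<Rightarrow> ereal" where
  "slope u x = limsup_to x (\<lambda>y. ereal (\<bar>u y - u x\<bar> / dist x y))"

definition slope_plus :: "('a::metric_space \<Rightarrow> real) \<Rightarrow> 'a \<Rightarrow> ereal" where
  "slope_plus u x = limsup_to x (\<lambda>y. ereal (max (u y - u x) 0 / dist x y))"

definition slope_minus :: "('a::metric_space \<Rightarrow> real) \<Rightarrow> 'a \<Rightarrow> ereal" where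
  "slope_minus u x = limsup_to x (\<lambda>y. ereal (max (u x - u y) 0 / dist x y))"

definition slope_star :: "('a::metric_space \<Rightarrow> real) \<Rightarrow> 'a \<Rightarrow> ereal" where
  "slope_star u x = limsup_to x (slope u)"

subsection \<open>Supersolutions of the eikonal equation\<close>

definition monge_supersolution ::
    "'a::metric_space set \<Rightarrow> ('a \<Rightarrow> real) \<Rightarrow> ('a \<Rightarrow> real) \<Rightarrow> bool" where
  "monge_supersolution \<Omega> f u \<longleftrightarrow>
     u \<in> Lip_loc \<Omega> \<and> (\<forall>x\<in>\<Omega>. slope_minus u x \<ge> ereal (f x))"

definition super_test_class :: "'a::metric_space set \<Rightarrow> ('a \<Rightarrow> real) set" where
  "super_test_class \<Omega> =
     {\<psi> \<in> Lip_loc \<Omega>. (\<forall>x\<in>\<Omega>. slope_plus \<psi> x = slope \<psi> x) \<and> continuous_on \<Omega> (slope \<psi>)}"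

definition s_supersolution ::
    "'a::metric_space set \<Rightarrow> ('a \<Rightarrow> real) \<Rightarrow> ('a \<Rightarrow> real) \<Rightarrow> bool" where
  "s_supersolution \<Omega> f u \<longleftrightarrow>
     lsc_on \<Omega> u \<and>
     (\<forall>\<psi>1 \<in> super_test_class \<Omega>. \<forall>\<psi>2 \<in> Lip_loc \<Omega>. \<forall>x\<in>\<Omega>.
        local_min_at (\<lambda>y. u y - \<psi>1 y - \<psi>2 y) x \<longrightarrow>
        slope \<psi>1 x \<ge> ereal (f x) - slope_star \<psi>2 x)"

definition admissible_curves :: "'a::metric_space \<Rightarrow> (real \<Rightarrow> 'a) set" where
  "admissible_curves x = {\<xi>. 1-lipschitz_on UNIV \<xi> \<and> \<xi> 0 = x}"

definition exit_time_plus :: "'a set \<Rightarrow> (real \<Rightarrow> 'a) \<Rightarrow> ereal" where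
  "exit_time_plus U \<xi> = Inf (ereal ` {t. t \<ge> 0 \<and> \<xi> t \<notin> U})"

definition exit_time_minus :: "'a set \<Rightarrow> (real \<Rightarrow> 'a) \<Rightarrow> ereal" where
  "exit_time_minus U \<xi> = Sup (ereal ` {t. t \<le> 0 \<and> \<xi> t \<notin> U})"

definition exit_interval :: "'a set \<Rightarrow> (real \<Rightarrow> 'a) \<Rightarrow> real set" where
  "exit_interval U \<xi> = {t. exit_time_minus U \<xi> < ereal t \<and> ereal t < exit_time_plus U \<xi>}"

text \<open>
  As usual for viscosity solutions, a test function touches \<open>w\<close> at a local minimum of \<open>w - \<phi>\<close>.
  A minimum over the whole exit interval would not do: on \<open>\<Omega> = {-1<..<1}\<close> in the real line let
  \<open>u x = ln (1 - x\<^sup>2)\<close>. Take \<open>r = 1 - \<bar>x\<bar>\<close>, let \<open>\<xi>\<close> run from \<open>x\<close> to the nearer end point of \<open>\<Omega>\<close> in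
  both time directions, and put \<open>w = u \<circ> \<xi>\<close>. Then \<open>w\<close> tends to \<open>-\<infinity>\<close> at both ends of the exit
  interval, so \<open>w - \<phi>\<close> has no global minimum for any \<open>\<phi>\<close>, and the test would hold for every \<open>f\<close>.
\<close>
definition local_c_supersolution ::
    "'a::metric_space set \<Rightarrow> ('a \<Rightarrow> real) \<Rightarrow> ('a \<Rightarrow> real) \<Rightarrow> bool" where
  "local_c_supersolution \<Omega> f u \<longleftrightarrow>
     lsc_on \<Omega> u \<and>
     (\<forall>x\<in>\<Omega>. \<exists>r>0. ball x r \<subseteq> \<Omega> \<and>
        (\<forall>\<epsilon>>0. \<exists>\<xi> \<in> admissible_curves x. \<exists>w :: real \<Rightarrow> real.
           lsc_on (exit_interval (ball x r) \<xi>) w \<and>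
           w 0 = u x \<and>
           (\<forall>t \<in> exit_interval (ball x r) \<xi>. w t \<ge> u (\<xi> t) - \<epsilon>) \<and>
           (\<forall>\<phi> :: real \<Rightarrow> real. \<forall>t0 \<in> exit_interval (ball x r) \<xi>.
              \<phi> C1_differentiable_on UNIV \<longrightarrow> local_min_at (\<lambda>t. w t - \<phi> t) t0 \<longrightarrow>
              \<bar>deriv \<phi> t0\<bar> \<ge> f (\<xi> t0) - \<epsilon>)))"

end

theory Submission
  imports Defs
begin

text \<open>
  In (i), a local minimum of \<open>u - \<psi>\<^sub>1 - \<psi>\<^sub>2\<close> bounds the descending slope of \<open>u\<close> by the sum of
  the slopes of \<open>\<psi>\<^sub>1\<close> and \<open>\<psi>\<^sub>2\<close>, and in a length space the slope at a point never exceeds the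
  punctured upper limit of the slopes nearby. Conversely, if the descending slope of \<open>u\<close> at \<open>x\<close>
  is below \<open>c < f x\<close>, then \<open>\<psi>\<^sub>1 = 0\<close> and \<open>\<psi>\<^sub>2 = - c d(x, \<cdot>)\<close> violate the s-supersolution test.
  In (ii) the same bound gives \<open>w t \<ge> u x - c \<bar>t\<bar> - \<epsilon>\<close> near \<open>0\<close>, so a smoothed \<open>- c' \<bar>t\<bar>\<close>
  with \<open>c'\<close> slightly above \<open>c\<close> touches \<open>w\<close> from below at an interior point, with derivative
  bounded by \<open>c'\<close>.
\<close>

section \<open>Slopes as bounds on differences near a point\<close>

lemma eventually_less_if_limsup_to_less:
  assumes "limsup_to x g < c"
  shows "\<forall>\<^sub>F y in at x. g y < c"
  using assms by (cases "at x = bot") (auto simp: limsup_to_def dest: Limsup_lessD)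

text \<open>The assumption \<open>0 \<le> c\<close> serves the isolated points, where
  \<open>limsup_to\<close> is 0 whatever \<open>g\<close> is.\<close>

lemma limsup_to_le:
  assumes "\<forall>\<^sub>F y in at x. g y \<le> c" "0 \<le> c"
  shows "limsup_to x g \<le> c"
  using assms by (auto simp: limsup_to_def intro: Limsup_bounded)

lemma limsup_to_nonneg:
  assumes "\<And>y. 0 \<le> g y"
  shows "0 \<le> limsup_to x g"
  using assms by (auto simp: limsup_to_def intro!: le_Limsup)

lemma slope_nonneg: "0 \<le> slope u x"
  unfolding slope_def by (rule limsup_to_nonneg) simp

lemma slope_minus_nonneg: "0 \<le> slope_minus u x"
  unfolding slope_minus_def by (rule limsup_to_nonneg) simp

lemma slope_star_nonneg: "0 \<le> slope_star u x"
  unfolding slope_star_def by (rule limsup_to_nonneg) (rule slope_nonneg)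

text \<open>A strict inequality for an upper limit gives a bound on a punctured neighbourhood. The
  centre can be added because both sides vanish at \<open>y = x\<close>.\<close>

lemma eventually_le_if_slope_less:
  assumes "slope u x < ereal c"
  shows "\<forall>\<^sub>F y in nhds x. \<bar>u y - u x\<bar> \<le> c * dist x y"
proof -
  have "\<forall>\<^sub>F y in at x. ereal (\<bar>u y - u x\<bar> / dist x y) < ereal c"
    using assms unfolding slope_def by (rule eventually_less_if_limsup_to_less)
  then have "\<forall>\<^sub>F y in at x. \<bar>u y - u x\<bar> \<le> c * dist x y"
    unfolding eventually_at_filter
    by eventually_elim (auto simp: divide_simps split: if_splits)
  then show ?thesis
    unfolding eventually_nhds_conv_at by simp
qed

lemma slope_le:
  assumes "\<forall>\<^sub>F y in nhds x. \<bar>u y - u x\<bar> \<le> c * dist x y" "0 \<le> c"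
  shows "slope u x \<le> ereal c"
  unfolding slope_def
proof (rule limsup_to_le)
  show "\<forall>\<^sub>F y in at x. ereal (\<bar>u y - u x\<bar> / dist x y) \<le> ereal c"
    using assms(1) unfolding eventually_at_filter
    by eventually_elim (auto simp: divide_simps)
qed (use assms in simp)

lemma eventually_ge_if_slope_minus_less:
  assumes "slope_minus u x < ereal c"
  shows "\<forall>\<^sub>F y in nhds x. u x - u y \<le> c * dist x y"
proof -
  have "\<forall>\<^sub>F y in at x. ereal (max (u x - u y) 0 / dist x y) < ereal c"
    using assms unfolding slope_minus_def by (rule eventually_less_if_limsup_to_less)
  then have "\<forall>\<^sub>F y in at x. u x - u y \<le> c * dist x y"
    unfolding eventually_at_filter
    by eventually_elim (auto simp: divide_simps split: if_splits)
  then show ?thesis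
    unfolding eventually_nhds_conv_at by simp
qed

text \<open>Besides isolated points, \<open>0 \<le> c\<close> covers the \<open>y\<close> with
  \<open>u y \<ge> u x\<close>, where the positive part in the quotient is 0.\<close>

lemma slope_minus_le:
  assumes "\<forall>\<^sub>F y in nhds x. u x - u y \<le> c * dist x y" "0 \<le> c"
  shows "slope_minus u x \<le> ereal c"
  unfolding slope_minus_def
proof (rule limsup_to_le)
  show "\<forall>\<^sub>F y in at x. ereal (max (u x - u y) 0 / dist x y) \<le> ereal c"
    using assms(1) unfolding eventually_at_filter
    by eventually_elim (use assms(2) in \<open>auto simp: divide_simps\<close>)
qed (use assms in simp)

lemma slope_const: "slope (\<lambda>_. c) x = 0"
  using slope_le[of "\<lambda>_. c" x 0] slope_nonneg[of "\<lambda>_. c" x]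
  by (simp add: zero_ereal_def)

section \<open>Locally Lipschitz functions\<close>

lemma lipschitz_imp_Lip_loc:
  assumes "open \<Omega>" "L-lipschitz_on \<Omega> u"
  shows "u \<in> Lip_loc \<Omega>"
  unfolding Lip_loc_def
proof (rule CollectI, rule ballI)
  fix x assume "x \<in> \<Omega>"
  then obtain r where "r > 0" "ball x r \<subseteq> \<Omega>"
    using assms(1) openE by blast
  with lipschitz_on_subset[OF assms(2)]
  show "\<exists>r>0. ball x r \<subseteq> \<Omega> \<and> (\<exists>L. L-lipschitz_on (ball x r) u)"
    by blast
qed

text \<open>With zero as \<open>\<psi>1\<close>, the left side of the s-supersolution test vanishes
  and the test becomes a lower bound for \<open>slope_star \<psi>2\<close>.\<close>

lemma zero_in_super_test_class:
  assumes "open \<Omega>"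
  shows "(\<lambda>_. 0) \<in> super_test_class \<Omega>"
proof -
  have "slope_plus (\<lambda>_. 0) x = slope (\<lambda>_. 0) x" for x :: 'a
    by (simp add: slope_plus_def slope_def)
  moreover have "slope (\<lambda>_. 0) = (\<lambda>_::'a. 0)"
    by (rule ext) (rule slope_const)
  moreover have "(\<lambda>_. 0) \<in> Lip_loc \<Omega>"
    by (rule lipschitz_imp_Lip_loc[OF assms, of 0]) (simp add: lipschitz_on_constant)
  ultimately show ?thesis
    by (simp add: super_test_class_def)
qed

lemma Lip_loc_continuous_at:
  assumes "u \<in> Lip_loc \<Omega>" "x \<in> \<Omega>"
  shows "isCont u x"
proof -
  obtain r L where r: "r > 0" "L-lipschitz_on (ball x r) u"
    using assms by (auto simp: Lip_loc_def)
  then have "continuous_on (ball x r) u"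
    by (auto intro: lipschitz_on_continuous_on)
  then show ?thesis
    using r by (simp add: continuous_on_eq_continuous_at)
qed

lemma Lip_loc_lsc_on:
  assumes "u \<in> Lip_loc \<Omega>"
  shows "lsc_on \<Omega> u"
  unfolding lsc_on_def
proof
  fix x assume "x \<in> \<Omega>"
  show "ereal (u x) \<le> Liminf (at x within \<Omega>) (\<lambda>y. ereal (u y))"
  \<comment> \<open>Along the trivial filter the lower limit is \<open>\<infinity>\<close>;
    otherwise it equals \<open>u x\<close> by continuity.\<close>
  proof (cases "at x within \<Omega> = bot")
    case False
    have "(u \<longlongrightarrow> u x) (at x within \<Omega>)"
      using Lip_loc_continuous_at[OF assms \<open>x \<in> \<Omega>\<close>]
      by (meson continuous_at continuous_within continuous_at_imp_continuous_at_within)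
    then have "((\<lambda>y. ereal (u y)) \<longlongrightarrow> ereal (u x)) (at x within \<Omega>)"
      by simp
    from lim_imp_Liminf[OF False this] show ?thesis
      by simp
  qed simp
qed

text \<open>A local Lipschitz constant bounds the difference quotients. Finiteness later allows the
  slopes of both test functions to be treated as reals.\<close>

lemma slope_finite:
  assumes "u \<in> Lip_loc \<Omega>" "x \<in> \<Omega>"
  shows "slope u x < \<infinity>"
proof -
  obtain r L where r: "r > 0" "L-lipschitz_on (ball x r) u"
    using assms by (auto simp: Lip_loc_def)
  have "\<forall>\<^sub>F y in nhds x. \<bar>u y - u x\<bar> \<le> L * dist x y"
    using eventually_nhds_ball[OF r(1), of x]
    by eventually_elim
      (use lipschitz_onD[OF r(2)] r(1) in \<open>simp add: dist_real_def dist_commute\<close>)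
  then have "slope u x \<le> ereal L"
    using lipschitz_on_nonneg[OF r(2)] by (rule slope_le)
  then show ?thesis by auto
qed

section \<open>Polygonal sums and slope bounds along curves\<close>

definition poly_sum :: "(real \<Rightarrow> 'a::metric_space) \<Rightarrow> real list \<Rightarrow> real" where
  "poly_sum \<gamma> ts = (\<Sum>i < length ts - 1. dist (\<gamma> (ts ! i)) (\<gamma> (ts ! Suc i)))"

lemma poly_sum_le_curve_length:
  assumes "sorted ts" "set ts \<subseteq> {0..1}"
  shows "ereal (poly_sum \<gamma> ts) \<le> curve_length \<gamma>"
  unfolding curve_length_def poly_sum_def using assms by (intro SUP_upper) auto

lemma poly_sum_Cons: "poly_sum \<gamma> (s # t # ts) = dist (\<gamma> s) (\<gamma> t) + poly_sum \<gamma> (t # ts)"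
  by (simp add: poly_sum_def sum.lessThan_Suc_shift del: sum.lessThan_Suc)

text \<open>The junction \<open>t\<close> belongs to both lists, so each edge is counted exactly
  once.\<close>

lemma poly_sum_join: "poly_sum \<gamma> (ss @ t # ts) = poly_sum \<gamma> (ss @ [t]) + poly_sum \<gamma> (t # ts)"
proof (induction ss)
  case Nil
  show ?case by (simp add: poly_sum_def)
next
  case (Cons s ss)
  then show ?case by (cases ss) (auto simp: poly_sum_Cons)
qed

text \<open>The radius \<open>\<eta>\<close> depends on \<open>t\<close>, so the passage to the
  whole interval uses the bisection principle \<open>Bolzano\<close>: short intervals have a chain,
  and chains over adjacent intervals are spliced by the triangle inequality.\<close>

lemma local_bound_imp_chain_bound:
  fixes \<psi> :: "'a::metric_space \<Rightarrow> real" and \<gamma> :: "real \<Rightarrow> 'a"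
  assumes "a \<le> b"
    and loc: "\<And>t. a \<le> t \<Longrightarrow> t \<le> b \<Longrightarrow>
      \<exists>\<eta>>0. \<forall>s. \<bar>s - t\<bar> < \<eta> \<longrightarrow> s \<in> {a..b} \<longrightarrow> \<bar>\<psi> (\<gamma> s) - \<psi> (\<gamma> t)\<bar> \<le> M * dist (\<gamma> t) (\<gamma> s)"
  shows "\<exists>ts. sorted ts \<and> set ts \<subseteq> {a..b} \<and> \<bar>\<psi> (\<gamma> b) - \<psi> (\<gamma> a)\<bar> \<le> M * poly_sum \<gamma> ts"
proof -
  \<comment> \<open>The end points are kept in the list so that chains can be spliced there. The
    premise makes \<open>P\<close> vacuous on intervals sticking out of \<open>{a..b}\<close>, which
    \<open>Bolzano\<close> also presents.\<close>
  define P where "P = (\<lambda>p q. a \<le> p \<and> q \<le> b \<longrightarrow> (\<exists>ss. sorted (p # ss @ [q]) \<and>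
     \<bar>\<psi> (\<gamma> q) - \<psi> (\<gamma> p)\<bar> \<le> M * poly_sum \<gamma> (p # ss @ [q])))"
  have "P a b"
    using \<open>a \<le> b\<close>
  proof (induction rule: Bolzano)
    case (trans p q r)
    show ?case
      unfolding P_def
    proof
      assume "a \<le> p \<and> r \<le> b"
      then obtain ss ts where ss: "sorted (p # ss @ [q])"
          "\<bar>\<psi> (\<gamma> q) - \<psi> (\<gamma> p)\<bar> \<le> M * poly_sum \<gamma> (p # ss @ [q])"
        and ts: "sorted (q # ts @ [r])"
          "\<bar>\<psi> (\<gamma> r) - \<psi> (\<gamma> q)\<bar> \<le> M * poly_sum \<gamma> (q # ts @ [r])"
        using trans unfolding P_def by fastforce
      have "sorted (p # (ss @ q # ts) @ [r])"
        using ss ts by (fastforce simp: sorted_append)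
      moreover have "poly_sum \<gamma> (p # (ss @ q # ts) @ [r])
          = poly_sum \<gamma> (p # ss @ [q]) + poly_sum \<gamma> (q # ts @ [r])"
        using poly_sum_join[of \<gamma> "p # ss" q "ts @ [r]"] by simp
      ultimately show "\<exists>ss. sorted (p # ss @ [r]) \<and>
          \<bar>\<psi> (\<gamma> r) - \<psi> (\<gamma> p)\<bar> \<le> M * poly_sum \<gamma> (p # ss @ [r])"
        using ss(2) ts(2) by (intro exI[of _ "ss @ q # ts"]) (auto simp: algebra_simps)
    qed
  next
    case (local t)
    then obtain \<eta> where "\<eta> > 0" and \<eta>: "\<And>s. \<bar>s - t\<bar> < \<eta> \<Longrightarrow> s \<in> {a..b} \<Longrightarrow>
        \<bar>\<psi> (\<gamma> s) - \<psi> (\<gamma> t)\<bar> \<le> M * dist (\<gamma> t) (\<gamma> s)"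
      using loc by blast
    \<comment> \<open>The local bound compares only with the centre \<open>t\<close>, hence the
      chain through \<open>p\<close>, \<open>t\<close>, \<open>q\<close>.\<close>
    have "P p q" if "p \<le> t" "t \<le> q" "q - p < \<eta>" for p q
      unfolding P_def
    proof
      assume "a \<le> p \<and> q \<le> b"
      then have "\<bar>\<psi> (\<gamma> p) - \<psi> (\<gamma> t)\<bar> \<le> M * dist (\<gamma> t) (\<gamma> p)"
        "\<bar>\<psi> (\<gamma> q) - \<psi> (\<gamma> t)\<bar> \<le> M * dist (\<gamma> t) (\<gamma> q)"
        using that by (auto intro!: \<eta>)
      then have "\<bar>\<psi> (\<gamma> q) - \<psi> (\<gamma> p)\<bar> \<le> M * poly_sum \<gamma> (p # [t] @ [q])"
        by (simp add: poly_sum_def dist_commute algebra_simps)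
      then show "\<exists>ss. sorted (p # ss @ [q]) \<and>
          \<bar>\<psi> (\<gamma> q) - \<psi> (\<gamma> p)\<bar> \<le> M * poly_sum \<gamma> (p # ss @ [q])"
        using that by (intro exI[of _ "[t]"]) auto
    qed
    then show ?case
      using \<open>\<eta> > 0\<close> by blast
  qed
  then obtain ss where ss: "sorted (a # ss @ [b])"
      "\<bar>\<psi> (\<gamma> b) - \<psi> (\<gamma> a)\<bar> \<le> M * poly_sum \<gamma> (a # ss @ [b])"
    by (auto simp: P_def)
  moreover have "set (a # ss @ [b]) \<subseteq> {a..b}"
    using ss(1) \<open>a \<le> b\<close> by (auto simp: sorted_append)
  ultimately show ?thesis by blast
qed

text \<open>Continuity of \<open>\<gamma>\<close> turns the slope bound at \<open>\<gamma> t\<close>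
  into the local estimate of the chain lemma, and the polygonal sum of the resulting chain is at
  most the length of the whole curve.\<close>

lemma slope_bound_along_curve:
  assumes "path \<gamma>" "curve_length \<gamma> \<le> ereal l" "0 \<le> M"
    and "0 \<le> a" "a \<le> 1"
    and slope: "\<And>t. t \<in> {a..1} \<Longrightarrow> slope \<psi> (\<gamma> t) < ereal M"
  shows "\<bar>\<psi> (\<gamma> 1) - \<psi> (\<gamma> a)\<bar> \<le> M * l"
proof -
  have "\<exists>\<eta>>0. \<forall>s. \<bar>s - t\<bar> < \<eta> \<longrightarrow> s \<in> {a..1} \<longrightarrow> \<bar>\<psi> (\<gamma> s) - \<psi> (\<gamma> t)\<bar> \<le> M * dist (\<gamma> t) (\<gamma> s)"
    if t: "a \<le> t" "t \<le> 1" for t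
  proof -
    have "\<forall>\<^sub>F y in nhds (\<gamma> t). \<bar>\<psi> y - \<psi> (\<gamma> t)\<bar> \<le> M * dist (\<gamma> t) y"
      using t by (intro eventually_le_if_slope_less slope) auto
    then obtain e where e: "e > 0" 
      "\<And>y. dist y (\<gamma> t) < e \<Longrightarrow> \<bar>\<psi> y - \<psi> (\<gamma> t)\<bar> \<le> M * dist (\<gamma> t) y"
      unfolding eventually_nhds_metric by blast
    have "t \<in> {0..1}" using t \<open>0 \<le> a\<close> by auto
    then obtain \<eta> where "\<eta> > 0" "\<And>s. s \<in> {0..1} \<Longrightarrow> dist s t < \<eta> \<Longrightarrow> dist (\<gamma> s) (\<gamma> t) < e"
      using \<open>path \<gamma>\<close> e(1) unfolding path_def continuous_on_iff by blast
    with e(2) \<open>0 \<le> a\<close> show ?thesis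
      by (intro exI[of _ \<eta>]) (auto simp: dist_real_def)
  qed
  with \<open>a \<le> 1\<close> obtain ts where ts: "sorted ts" "set ts \<subseteq> {a..1}"
      "\<bar>\<psi> (\<gamma> 1) - \<psi> (\<gamma> a)\<bar> \<le> M * poly_sum \<gamma> ts"
    using local_bound_imp_chain_bound[of a 1 \<psi> \<gamma> M] by blast
  have "ereal (poly_sum \<gamma> ts) \<le> ereal l"
    using poly_sum_le_curve_length[of ts \<gamma>] ts \<open>0 \<le> a\<close> assms(2) 
    by (meson atLeastatMost_subset_iff order.refl order.trans)
  with ts(3) \<open>0 \<le> M\<close> show ?thesis
    by (meson ereal_less_eq(3) mult_left_mono order.trans)
qed

text \<open>
  Nearly shortest curves from \<open>x\<close> to \<open>y\<close> are cut at their last visit of \<open>x\<close>, so that only slopes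
  at points other than \<open>x\<close> enter.
\<close>
lemma slope_le_slope_star:
  fixes \<psi> :: "'a::metric_space \<Rightarrow> real"
  assumes "length_space (UNIV :: 'a set)" "isCont \<psi> x"
  shows "slope \<psi> x \<le> slope_star \<psi> x"
proof (rule ccontr)
  assume "\<not> ?thesis"
  then obtain M where M: "slope_star \<psi> x < ereal M" "ereal M < slope \<psi> x"
    using ereal_dense2 not_le by metis
  then have "0 \<le> M"
    using slope_star_nonneg[of \<psi> x] by (metis ereal_less_eq(5) less_le order_trans)
  have "\<forall>\<^sub>F y in at x. slope \<psi> y < ereal M"
    using M(1) unfolding slope_star_def by (rule eventually_less_if_limsup_to_less)
  then obtain R where R: "R > 0" "\<And>y. y \<noteq> x \<Longrightarrow> dist y x < R \<Longrightarrow> slope \<psi> y < ereal M"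
    unfolding eventually_at by auto
  have "\<bar>\<psi> y - \<psi> x\<bar> \<le> M * dist x y" if y: "dist y x < R" for y
  proof (cases "y = x")
    case False
    \<comment> \<open>The distance is only the infimum of the lengths, so a curve is available for
      each larger \<open>l\<close>; \<open>l < R\<close> keeps it in the ball where slopes off
      \<open>x\<close> are below \<open>M\<close>.\<close>
    have bound: "\<bar>\<psi> y - \<psi> x\<bar> \<le> M * l" if l: "dist x y < l" "l < R" for l
    proof -
      have "(INF \<gamma> \<in> {\<gamma>. path \<gamma> \<and> path_image \<gamma> \<subseteq> UNIV \<and> pathstart \<gamma> = x \<and> pathfinish \<gamma> = y}.
          curve_length \<gamma>) < ereal l"
        unfolding assms(1)[unfolded length_space_def, THEN bspec, THEN bspec,
            OF UNIV_I UNIV_I, symmetric]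
        using l by simp
      then obtain \<gamma> where \<gamma>: "path \<gamma>" "\<gamma> 0 = x" "\<gamma> 1 = y" "curve_length \<gamma> < ereal l"
        unfolding INF_less_iff by (auto simp: pathstart_def pathfinish_def)
      have near: "dist (\<gamma> t) x < R" if "t \<in> {0..1}" for t
      proof -
        \<comment> \<open>The single edge from \<open>\<gamma> 0\<close> to
          \<open>\<gamma> t\<close> is already at most the length.\<close>
        have "ereal (poly_sum \<gamma> [0, t]) \<le> curve_length \<gamma>"
          using that by (intro poly_sum_le_curve_length) auto
        also have "\<dots> < ereal l" by (rule \<gamma>)
        finally have "dist x (\<gamma> t) < l" by (simp add: poly_sum_def \<gamma>(2))
        then show ?thesis using l by (simp add: dist_commute)
      qed
      define Z where "Z = {t \<in> {0..1}. \<gamma> t = x}"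
      have cont: "continuous_on {0..1} \<gamma>"
        using \<gamma>(1) by (simp add: path_def)
      have "closed Z"
        unfolding Z_def using cont by (intro continuous_closed_preimage_constant) auto
      then have "compact Z"
        unfolding compact_eq_bounded_closed
        by (auto simp: Z_def intro: bounded_subset[of "{0..1}"])
      moreover have "0 \<in> Z" using \<gamma> by (simp add: Z_def)
      ultimately obtain c where c: "c \<in> Z" "\<And>t. t \<in> Z \<Longrightarrow> t \<le> c"
        using compact_attains_sup[of Z] by blast
      have "c < 1"
        using c \<gamma> False by (cases "c = 1") (auto simp: Z_def)
      \<comment> \<open>At time \<open>c\<close> the curve is at \<open>x\<close>, where the slope
        exceeds \<open>M\<close>. The estimate is therefore made on \<open>{a..1}\<close> with
        \<open>a > c\<close>, and \<open>a\<close> then decreases to \<open>c\<close> using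
        continuity of \<open>\<psi>\<close> at \<open>x\<close>.\<close>
      have ev: "\<forall>\<^sub>F a in at_right c. \<bar>\<psi> y - \<psi> (\<gamma> a)\<bar> \<le> M * l"
        unfolding eventually_at_right_field
      proof (intro exI[of _ 1] conjI allI impI)
        fix a assume a: "c < a" "a < 1"
        have "slope \<psi> (\<gamma> t) < ereal M" if "t \<in> {a..1}" for t
        proof (rule R)
          have t: "t \<in> {0..1}" using that a c(1) by (auto simp: Z_def)
          then show "dist (\<gamma> t) x < R" by (rule near)
          show "\<gamma> t \<noteq> x" using that t a c(2)[of t] by (auto simp: Z_def)
        qed
        then show "\<bar>\<psi> y - \<psi> (\<gamma> a)\<bar> \<le> M * l"
          using slope_bound_along_curve[of \<gamma> l M a \<psi>] \<gamma> a c(1) \<open>0 \<le> M\<close> by (auto simp: Z_def)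
      qed (use \<open>c < 1\<close> in simp)
      have "(\<gamma> \<longlongrightarrow> x) (at c within {0..1})"
        using cont c(1) by (auto simp: Z_def continuous_on_def)
      then have "(\<gamma> \<longlongrightarrow> x) (at c within {c..1})"
        by (rule tendsto_within_subset) (use c(1) in \<open>auto simp: Z_def\<close>)
      then have "(\<gamma> \<longlongrightarrow> x) (at_right c)"
        using at_within_Icc_at_right[OF \<open>c < 1\<close>] by simp
      then have "((\<lambda>a. \<bar>\<psi> y - \<psi> (\<gamma> a)\<bar>) \<longlongrightarrow> \<bar>\<psi> y - \<psi> x\<bar>) (at_right c)"
        by (intro tendsto_intros isCont_tendsto_compose[OF assms(2)])
      then show ?thesis
        using ev by (rule tendsto_upperbound) simp
    qed
    \<comment> \<open>Now \<open>l\<close> decreases to the distance itself.\<close>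
    have "((\<lambda>l. M * l) \<longlongrightarrow> M * dist x y) (at_right (dist x y))"
      by (intro tendsto_intros)
    moreover have "\<forall>\<^sub>F l in at_right (dist x y). \<bar>\<psi> y - \<psi> x\<bar> \<le> M * l"
      unfolding eventually_at_right_field
      using y bound by (intro exI[of _ R]) (auto simp: dist_commute)
    ultimately show ?thesis
      by (rule tendsto_lowerbound) simp
  qed simp
  then have "slope \<psi> x \<le> ereal M"
    using R(1) \<open>0 \<le> M\<close> by (intro slope_le) (auto simp: eventually_nhds_metric)
  with M(2) show False by simp
qed

section \<open>Monge supersolutions and s-supersolutions\<close>

lemma monge_imp_s_supersolution:
  fixes \<Omega> :: "'a::metric_space set"
  assumes "length_space (UNIV :: 'a set)" "monge_supersolution \<Omega> f u"
  shows "s_supersolution \<Omega> f u"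
  unfolding s_supersolution_def
proof (intro conjI ballI impI)
  show "lsc_on \<Omega> u"
    using assms(2) by (intro Lip_loc_lsc_on) (simp add: monge_supersolution_def)
next
  fix \<psi>1 \<psi>2 x
  assume \<psi>: "\<psi>1 \<in> super_test_class \<Omega>" "\<psi>2 \<in> Lip_loc \<Omega>" and x: "x \<in> \<Omega>"
    and min: "local_min_at (\<lambda>y. u y - \<psi>1 y - \<psi>2 y) x"
  have fin: "slope \<psi>1 x < \<infinity>" "slope \<psi>2 x < \<infinity>"
    using \<psi> x slope_finite[of _ \<Omega> x] by (simp_all add: super_test_class_def)
  \<comment> \<open>Strict majorants \<open>c1\<close>, \<open>c2\<close> of the slopes give bounds
    on a whole neighbourhood, which the minimum transfers to \<open>u\<close>; afterwards they are
    pushed down to the slopes.\<close>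
  have le: "f x \<le> c1 + c2" if c: "slope \<psi>1 x < ereal c1" "slope \<psi>2 x < ereal c2" for c1 c2
  proof -
    have "\<forall>\<^sub>F y in nhds x. u x - u y \<le> (c1 + c2) * dist x y"
      using eventually_le_if_slope_less[OF c(1)] eventually_le_if_slope_less[OF c(2)]
        min[unfolded local_min_at_def]
      by eventually_elim (simp add: algebra_simps)
    moreover have "0 \<le> c1 + c2"
      using c slope_nonneg[of \<psi>1 x] slope_nonneg[of \<psi>2 x]
      by (metis add_nonneg_nonneg ereal_less_eq(5) order.strict_implies_order order_trans)
    ultimately have "slope_minus u x \<le> ereal (c1 + c2)"
      by (rule slope_minus_le)
    then have "ereal (f x) \<le> ereal (c1 + c2)"
      using assms(2) x by (meson monge_supersolution_def order_trans)
    then show ?thesis by simp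
  qed
  obtain s1 s2 where s: "slope \<psi>1 x = ereal s1" "slope \<psi>2 x = ereal s2"
    using fin slope_nonneg[of \<psi>1 x] slope_nonneg[of \<psi>2 x]
    by (cases "slope \<psi>1 x"; cases "slope \<psi>2 x") auto
  have "f x \<le> s1 + s2"
  proof (rule field_le_epsilon)
    fix e :: real assume "e > 0"
    then show "f x \<le> s1 + s2 + e"
      using le[of "s1 + e / 2" "s2 + e / 2"] s by simp
  qed
  then have "ereal (f x) - slope \<psi>2 x \<le> slope \<psi>1 x"
    by (simp add: s)
  \<comment> \<open>The upper limit in \<open>slope_star\<close> is punctured and does not see the
    slope at \<open>x\<close> itself; the length space property enters here.\<close>
  moreover have "slope \<psi>2 x \<le> slope_star \<psi>2 x"
    using assms(1) \<psi>(2) x by (intro slope_le_slope_star Lip_loc_continuous_at)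
  ultimately show "ereal (f x) - slope_star \<psi>2 x \<le> slope \<psi>1 x"
    by (meson ereal_minus_mono order.refl order.trans)
qed

lemma s_imp_monge_supersolution:
  assumes "open \<Omega>" "u \<in> Lip_loc \<Omega>" "s_supersolution \<Omega> f u"
  shows "monge_supersolution \<Omega> f u"
  unfolding monge_supersolution_def
proof (intro conjI ballI, rule assms(2), rule ccontr)
  fix x assume x: "x \<in> \<Omega>" and "\<not> ereal (f x) \<le> slope_minus u x"
  then obtain c where c: "slope_minus u x < ereal c" "ereal c < ereal (f x)"
    using ereal_dense2 not_le by metis
  then have "0 \<le> c"
    using slope_minus_nonneg[of u x] by (metis ereal_less_eq(5) less_le order_trans)
  \<comment> \<open>A downward cone with vertex \<open>x\<close>: the bound on the descent of
    \<open>u\<close> near \<open>x\<close> says exactly that \<open>u - \<psi>\<close> has a local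
    minimum there.\<close>
  define \<psi> where "\<psi> y = - c * dist x y" for y
  have lip: "\<bar>\<psi> z - \<psi> y\<bar> \<le> c * dist y z" for y z
  proof -
    have "\<bar>\<psi> z - \<psi> y\<bar> = c * \<bar>dist x y - dist x z\<bar>"
      using \<open>0 \<le> c\<close> by (simp add: \<psi>_def abs_mult flip: right_diff_distrib)
    also have "\<dots> \<le> c * dist y z"
      using \<open>0 \<le> c\<close> abs_dist_diff_le[of y x z] 
      by (intro mult_left_mono) (auto simp: dist_commute)
    finally show ?thesis .
  qed
  have "c-lipschitz_on \<Omega> \<psi>"
    using lip \<open>0 \<le> c\<close> by (intro lipschitz_onI) (auto simp: dist_real_def dist_commute)
  then have "\<psi> \<in> Lip_loc \<Omega>"
    by (rule lipschitz_imp_Lip_loc[OF \<open>open \<Omega>\<close>])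
  moreover have "local_min_at (\<lambda>y. u y - 0 - \<psi> y) x"
    using eventually_ge_if_slope_minus_less[OF c(1)] unfolding local_min_at_def
    by eventually_elim (simp add: \<psi>_def)
  ultimately have "ereal (f x) - slope_star \<psi> x \<le> slope (\<lambda>_. 0) x"
    using assms(3)[unfolded s_supersolution_def, THEN conjunct2, THEN bspec,
        OF zero_in_super_test_class[OF \<open>open \<Omega>\<close>], THEN bspec, THEN bspec, of \<psi> x] x
    by simp
  then have "ereal (f x) - slope_star \<psi> x \<le> 0"
    by (simp add: slope_const)
  \<comment> \<open>The cone is \<open>c\<close>-Lipschitz, so its slope is at most \<open>c\<close>
    everywhere; the test then forces \<open>f x \<le> c\<close>.\<close>
  moreover have "slope_star \<psi> x \<le> ereal c"
    unfolding slope_star_def using lip \<open>0 \<le> c\<close>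
    by (intro limsup_to_le) (auto intro!: always_eventually slope_le)
  ultimately show False
    using c(2) by (cases "slope_star \<psi> x") auto
qed

section \<open>From local c-supersolutions to Monge supersolutions\<close>

text \<open>A curve of speed at most 1 needs at least time \<open>r\<close> to leave a ball of
  radius \<open>r\<close> around its starting point, in either time direction.\<close>

lemma exit_interval_superset:
  assumes "\<xi> \<in> admissible_curves x" "\<bar>t\<bar> < r"
  shows "t \<in> exit_interval (ball x r) \<xi>"
proof -
  have far: "r \<le> \<bar>s\<bar>" if "\<xi> s \<notin> ball x r" for s
  proof -
    have "dist (\<xi> 0) (\<xi> s) \<le> 1 * dist 0 s"
      using assms(1) by (intro lipschitz_onD[of 1 UNIV]) (auto simp: admissible_curves_def)
    then show ?thesis
      using assms(1) that by (auto simp: admissible_curves_def)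
  qed
  have "ereal r \<le> exit_time_plus (ball x r) \<xi>"
    unfolding exit_time_plus_def using far by (intro Inf_greatest) fastforce
  moreover have "exit_time_minus (ball x r) \<xi> \<le> ereal (- r)"
    unfolding exit_time_minus_def using far by (intro Sup_least) fastforce
  moreover have "ereal t < ereal r" "ereal (- r) < ereal t"
    using assms(2) by auto
  ultimately show ?thesis
    by (simp add: exit_interval_def less_le_trans[of _ "ereal r"] le_less_trans[of _ "ereal (- r)"])
qed

lemma lsc_onD:
  assumes "lsc_on S w" "x \<in> S" "c < w x"
  shows "\<forall>\<^sub>F y in at x within S. c < w y"
proof -
  have "ereal c < Liminf (at x within S) (\<lambda>y. ereal (w y))"
    using assms less_le_trans[of "ereal c" "ereal (w x)"] by (simp add: lsc_on_def)
  then show ?thesis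
    by (auto dest: less_LiminfD)
qed

lemma lsc_minus_continuous_attains_min:
  fixes w \<phi> :: "'a::metric_space \<Rightarrow> real"
  assumes "lsc_on S w" "compact K" "K \<subseteq> S" "K \<noteq> {}" "continuous_on S \<phi>"
  shows "\<exists>t\<in>K. \<forall>s\<in>K. w t - \<phi> t \<le> w s - \<phi> s"
proof (rule ccontr)
  assume "\<not> ?thesis"
  then have *: "\<forall>t\<in>K. \<exists>s\<in>K. w s - \<phi> s < w t - \<phi> t"
    by (meson not_le)
  text \<open>
    Near each \<open>t\<close> in \<open>K\<close> the function stays above its value at a better point \<open>s t\<close>; the best of
    finitely many \<open>s t\<close> whose neighbourhoods cover \<open>K\<close> has no room left.
  \<close>
  then obtain s where s: "\<And>t. t \<in> K \<Longrightarrow> s t \<in> K \<and> w (s t) - \<phi> (s t) < w t - \<phi> t"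
    by metis
  have "\<exists>U. open U \<and> t \<in> U \<and> (\<forall>y\<in>U \<inter> S. w (s t) - \<phi> (s t) < w y - \<phi> y)" if t: "t \<in> K" for t
  proof -
    \<comment> \<open>Half the gap between the two values: \<open>w\<close> may drop by
      \<open>e\<close> and \<open>\<phi>\<close> rise by \<open>e\<close> before the gap
      closes.\<close>
    define e where "e = ((w t - \<phi> t) - (w (s t) - \<phi> (s t))) / 2"
    have "e > 0" using s[OF t] by (simp add: e_def)
    have tS: "t \<in> S" using t assms(3) by blast
    have "\<forall>\<^sub>F y in at t within S. w t - e < w y"
      using \<open>e > 0\<close> by (intro lsc_onD[OF assms(1) tS]) simp
    moreover have "\<forall>\<^sub>F y in at t within S. \<phi> y < \<phi> t + e"
      using assms(5) tS \<open>e > 0\<close> unfolding continuous_on_def 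
      by (intro order_tendstoD(2)[of \<phi> "\<phi> t"]) auto
    ultimately have "\<forall>\<^sub>F y in at t within S. w (s t) - \<phi> (s t) < w y - \<phi> y"
      by eventually_elim (simp add: e_def field_simps)
    then obtain U where "open U" "t \<in> U"
        "\<And>y. y \<in> U \<Longrightarrow> y \<noteq> t \<Longrightarrow> y \<in> S \<Longrightarrow> w (s t) - \<phi> (s t) < w y - \<phi> y"
      unfolding eventually_at_topological by blast
    with s[OF t] show ?thesis by (intro exI[of _ U]) auto
  qed
  then obtain U where U: "\<And>t. t \<in> K \<Longrightarrow> open (U t)" "\<And>t. t \<in> K \<Longrightarrow> t \<in> U t"
      "\<And>t y. t \<in> K \<Longrightarrow> y \<in> U t \<Longrightarrow> y \<in> S \<Longrightarrow> w (s t) - \<phi> (s t) < w y - \<phi> y"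
    by (metis IntI)
  obtain D where D: "D \<subseteq> K" "finite D" "K \<subseteq> (\<Union>t\<in>D. U t)"
    using compactE_image[OF assms(2), of K U] U(1,2) by blast
  have "D \<noteq> {}" using D(3) assms(4) by auto
  then obtain d where d: "d \<in> D" "\<And>t. t \<in> D \<Longrightarrow> w (s d) - \<phi> (s d) \<le> w (s t) - \<phi> (s t)"
    using D(2) ex_is_arg_min_if_finite[of D "\<lambda>t. w (s t) - \<phi> (s t)"]
    by (auto simp: is_arg_min_linorder)
  have "s d \<in> K" using s d D by blast
  then obtain t where t: "t \<in> D" "s d \<in> U t" using D by blast
  then have "w (s t) - \<phi> (s t) < w (s d) - \<phi> (s d)"
    using U(3)[of t "s d"] D \<open>s d \<in> K\<close> assms(3) by blast
  with d(2)[OF t(1)] show False by simp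
qed

text \<open>The parameter \<open>\<sigma>\<close> rounds off the corner of
  \<open>- c * \<bar>t\<bar>\<close> at 0, making it a C1 test function; the derivative bound
  survives because \<open>\<bar>t\<bar> \<le> sqrt (t\<^sup>2 + \<sigma>\<^sup>2)\<close>.\<close>

lemma smooth_abs:
  fixes c \<sigma> :: real
  assumes "\<sigma> > 0" "c \<ge> 0"
  defines "\<phi> \<equiv> \<lambda>t. - c * sqrt (t\<^sup>2 + \<sigma>\<^sup>2)"
  shows "\<phi> C1_differentiable_on UNIV" "\<bar>deriv \<phi> t\<bar> \<le> c"
proof -
  have pos: "t\<^sup>2 + \<sigma>\<^sup>2 > 0" for t
    using assms(1) by (simp add: add_nonneg_pos)
  have D: "(\<phi> has_real_derivative - c * (t / sqrt (t\<^sup>2 + \<sigma>\<^sup>2))) (at t)" for t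
    unfolding \<phi>_def using pos[of t]
    by (auto intro!: derivative_eq_intros simp: field_simps)
  show "\<phi> C1_differentiable_on UNIV"
    unfolding C1_differentiable_on_def
  proof (intro exI conjI ballI)
    show "(\<phi> has_vector_derivative - c * (t / sqrt (t\<^sup>2 + \<sigma>\<^sup>2))) (at t)" for t
      using D by (simp add: has_real_derivative_iff_has_vector_derivative)
    show "continuous_on UNIV (\<lambda>t. - c * (t / sqrt (t\<^sup>2 + \<sigma>\<^sup>2)))"
      using assms(1) by (intro continuous_intros) (simp add: sum_power2_eq_zero_iff)
  qed
  have "\<bar>t\<bar> \<le> sqrt (t\<^sup>2 + \<sigma>\<^sup>2)"
    by (rule real_sqrt_ge_abs1)
  then have "\<bar>t / sqrt (t\<^sup>2 + \<sigma>\<^sup>2)\<bar> \<le> 1"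
    using pos[of t] by (simp add: divide_le_eq_1)
  then have "c * \<bar>t / sqrt (t\<^sup>2 + \<sigma>\<^sup>2)\<bar> \<le> c"
    using assms(2) by (metis mult.right_neutral mult_left_mono)
  then show "\<bar>deriv \<phi> t\<bar> \<le> c"
    using assms(2) by (simp add: DERIV_imp_deriv[OF D] abs_mult)
qed

lemma c_imp_monge_supersolution:
  assumes cont: "\<And>x. x \<in> \<Omega> \<Longrightarrow> isCont f x"
    and "u \<in> Lip_loc \<Omega>" "local_c_supersolution \<Omega> f u"
  shows "monge_supersolution \<Omega> f u"
  unfolding monge_supersolution_def
proof (intro conjI ballI, rule assms(2), rule ccontr)
  fix x assume x: "x \<in> \<Omega>" and "\<not> ereal (f x) \<le> slope_minus u x"
  then obtain c where c: "slope_minus u x < ereal c" "c < f x"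
    using ereal_dense2 not_le by (metis ereal_less(2) less_ereal.simps(1))
  then have "0 \<le> c"
    using slope_minus_nonneg[of u x] by (metis ereal_less_eq(5) less_le order_trans)
  \<comment> \<open>The gap is split in three: the variation of \<open>f\<close>, the tolerance
    \<open>\<epsilon>\<close>, and the extra steepness of the test function.\<close>
  define \<eta> where "\<eta> = (f x - c) / 3"
  have "\<eta> > 0" using c by (simp add: \<eta>_def)
  obtain r where r: "r > 0" and super: "\<forall>\<epsilon>>0. \<exists>\<xi> \<in> admissible_curves x. \<exists>w :: real \<Rightarrow> real.
           lsc_on (exit_interval (ball x r) \<xi>) w \<and> w 0 = u x \<and>
           (\<forall>t \<in> exit_interval (ball x r) \<xi>. w t \<ge> u (\<xi> t) - \<epsilon>) \<and>
           (\<forall>\<phi> :: real \<Rightarrow> real. \<forall>t0 \<in> exit_interval (ball x r) \<xi>.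
              \<phi> C1_differentiable_on UNIV \<longrightarrow> local_min_at (\<lambda>t. w t - \<phi> t) t0 \<longrightarrow>
              \<bar>deriv \<phi> t0\<bar> \<ge> f (\<xi> t0) - \<epsilon>)"
    using assms(3)[unfolded local_c_supersolution_def, THEN conjunct2, THEN bspec, OF x]
    by (elim exE conjE) (rule that)
  have "\<forall>\<^sub>F y in nhds x. f x - \<eta> < f y"
    using cont[OF x] \<open>\<eta> > 0\<close> unfolding isCont_def
    by (intro order_tendstoD(1)[of f "f x"]) (simp_all add: tendsto_at_iff_tendsto_nhds)
  with eventually_ge_if_slope_minus_less[OF c(1)]
  have "\<forall>\<^sub>F y in nhds x. u x - u y \<le> c * dist x y \<and> f x - \<eta> < f y"
    by (rule eventually_conj)
  then obtain R where R: "R > 0"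
      "\<And>y. dist y x < R \<Longrightarrow> u x - u y \<le> c * dist x y" "\<And>y. dist y x < R \<Longrightarrow> f x - \<eta> < f y"
    unfolding eventually_nhds_metric by blast
  \<comment> \<open>Below \<open>r\<close>, so that \<open>{-\<rho>..\<rho>}\<close> lies in the
    exit interval, and below \<open>R\<close>, so that the curve stays where the estimates for
    \<open>u\<close> and \<open>f\<close> hold.\<close>
  define \<rho> where "\<rho> = min r R / 2"
  have \<rho>: "\<rho> > 0" "\<rho> < r" "\<rho> < R"
    using r R(1) by (auto simp: \<rho>_def)
  \<comment> \<open>The radius \<open>r\<close> is fixed before \<open>\<epsilon>\<close>, so
    \<open>\<epsilon>\<close> may depend on \<open>\<rho>\<close>. At time \<open>\<rho>\<close> the
    extra steepness gains \<open>\<eta> * \<rho>\<close>; the tolerance \<open>\<epsilon>\<close>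
    and the rounding \<open>(c + \<eta>) * \<sigma>\<close> may each consume a quarter of
    it.\<close>
  define \<epsilon> where "\<epsilon> = min (\<eta> / 2) (\<eta> * \<rho> / 4)"
  have \<epsilon>: "\<epsilon> > 0" "\<epsilon> < \<eta>" "\<epsilon> \<le> \<eta> * \<rho> / 4"
    using \<open>\<eta> > 0\<close> \<rho> by (auto simp: \<epsilon>_def min_def)
  define \<sigma> where "\<sigma> = \<eta> * \<rho> / 4 / (c + \<eta>)"
  have "c + \<eta> > 0"
    using \<open>\<eta> > 0\<close> \<open>0 \<le> c\<close> by simp
  then have \<sigma>: "\<sigma> > 0" "(c + \<eta>) * \<sigma> = \<eta> * \<rho> / 4"
    using \<open>\<eta> > 0\<close> \<rho> nonzero_eq_divide_eq[of "c + \<eta>" \<sigma>, THEN iffD1, OF _ \<sigma>_def]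
    by (simp_all add: \<sigma>_def mult.commute[of _ "c + \<eta>"])
  obtain \<xi> w where \<xi>: "\<xi> \<in> admissible_curves x"
    and w: "lsc_on (exit_interval (ball x r) \<xi>) w" "w 0 = u x"
      "\<And>t. t \<in> exit_interval (ball x r) \<xi> \<Longrightarrow> w t \<ge> u (\<xi> t) - \<epsilon>"
    and test: "\<And>\<phi> t0. t0 \<in> exit_interval (ball x r) \<xi> \<Longrightarrow>
       \<phi> C1_differentiable_on UNIV \<Longrightarrow> local_min_at (\<lambda>t. w t - \<phi> t) t0 \<Longrightarrow>
       \<bar>deriv \<phi> t0\<bar> \<ge> f (\<xi> t0) - \<epsilon>"
    using super[THEN spec, THEN mp, OF \<epsilon>(1)] by (elim bexE exE conjE) (rule that, blast+)
  define \<phi> where "\<phi> = (\<lambda>t. - (c + \<eta>) * sqrt (t\<^sup>2 + \<sigma>\<^sup>2))"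
  have \<phi>: "\<phi> C1_differentiable_on UNIV" "\<And>t. \<bar>deriv \<phi> t\<bar> \<le> c + \<eta>"
    unfolding \<phi>_def using \<sigma>(1) \<open>0 \<le> c\<close> \<open>\<eta> > 0\<close> by (intro smooth_abs; simp)+
  have I: "{-\<rho>..\<rho>} \<subseteq> exit_interval (ball x r) \<xi>"
    using exit_interval_superset[OF \<xi>, of _ r] \<rho>(2) by (auto simp: abs_less_iff)
  have \<phi>_cont: "continuous_on (exit_interval (ball x r) \<xi>) \<phi>"
    using C1_differentiable_imp_continuous_on[OF \<phi>(1)] continuous_on_subset by blast
  obtain t0 where t0: "t0 \<in> {-\<rho>..\<rho>}" "\<And>s. s \<in> {-\<rho>..\<rho>} \<Longrightarrow> w t0 - \<phi> t0 \<le> w s - \<phi> s"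
    using lsc_minus_continuous_attains_min[OF w(1) compact_Icc I _ \<phi>_cont] \<rho>(1) by auto
  have dist: "dist x (\<xi> t) \<le> \<bar>t\<bar>" for t
    using lipschitz_onD[of 1 UNIV \<xi> 0 t] \<xi> by (auto simp: admissible_curves_def)
  \<comment> \<open>At an end point \<open>w - \<phi>\<close> is at least
    \<open>u x + \<eta> * \<rho> - \<epsilon>\<close>, but at 0 it is only
    \<open>u x + \<eta> * \<rho> / 4\<close>. So the minimum over the compact interval is interior
    and hence a local minimum.\<close>
  have "\<bar>t0\<bar> \<noteq> \<rho>"
  proof
    assume eq: "\<bar>t0\<bar> = \<rho>"
    have "w t0 - \<phi> t0 \<le> w 0 - \<phi> 0"
      using \<rho>(1) by (intro t0(2)) auto
    then have "w t0 - \<phi> t0 \<le> u x + \<eta> * \<rho> / 4"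
      using w(2) \<sigma> by (simp add: \<phi>_def algebra_simps)
    moreover have "u x - u (\<xi> t0) \<le> c * dist x (\<xi> t0)"
      using dist[of t0] eq \<rho>(3) by (intro R(2)) (simp add: dist_commute)
    moreover have "c * dist x (\<xi> t0) \<le> c * \<rho>"
      using dist[of t0] eq \<open>0 \<le> c\<close> by (simp add: mult_left_mono)
    moreover have "w t0 \<ge> u (\<xi> t0) - \<epsilon>"
      using t0(1) I by (intro w(3)) blast
    moreover have "\<phi> t0 \<le> - (c + \<eta>) * \<rho>"
    proof -
      have "\<rho> \<le> sqrt (t0\<^sup>2 + \<sigma>\<^sup>2)"
        unfolding eq[symmetric] by (rule real_sqrt_ge_abs1)
      then show ?thesis
        using \<open>0 \<le> c\<close> \<open>\<eta> > 0\<close> by (simp add: \<phi>_def mult_left_mono)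
    qed
    moreover have "\<eta> * \<rho> > 0" using \<open>\<eta> > 0\<close> \<rho>(1) by simp
    ultimately show False
      using \<epsilon>(3) by (simp add: algebra_simps)
  qed
  then have int: "t0 \<in> {-\<rho><..<\<rho>}" using t0(1) by (auto simp: abs_if split: if_splits)
  have "\<forall>\<^sub>F t in nhds t0. t \<in> {-\<rho><..<\<rho>}"
    using int by (intro eventually_nhds_in_open) auto
  then have "local_min_at (\<lambda>t. w t - \<phi> t) t0"
    unfolding local_min_at_def by eventually_elim (auto intro: t0(2))
  \<comment> \<open>With \<open>f x - \<eta> < f (\<xi> t0)\<close> and
    \<open>\<epsilon> < \<eta>\<close> this yields \<open>f x - c < 3 * \<eta>\<close>, against the
    choice of \<open>\<eta>\<close>.\<close>
  then have "f (\<xi> t0) - \<epsilon> \<le> c + \<eta>"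
    using test[of t0 \<phi>] \<phi> t0(1) I by (meson order_trans subsetD)
  moreover have "f x - \<eta> < f (\<xi> t0)"
    using dist[of t0] int \<rho>(3) by (intro R(3)) (auto simp: dist_commute)
  ultimately show False
    using \<epsilon>(2) by (simp add: \<eta>_def field_simps)
qed

lemma locally_uniformly_continuous_on_imp_isCont:
  assumes "locally_uniformly_continuous_on \<Omega> f" "x \<in> \<Omega>"
  shows "isCont f x"
proof -
  obtain r where "r > 0" "uniformly_continuous_on (ball x r) f"
    using assms by (auto simp: locally_uniformly_continuous_on_def)
  then show ?thesis
    using uniformly_continuous_imp_continuous[of "ball x r" f]
    by (simp add: continuous_on_eq_continuous_at)
qed

theorem proposition4p7:
  fixes \<Omega> :: "'a::complete_space set" and f u :: "'a \<Rightarrow> real"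
  assumes "length_space (UNIV :: 'a set)"
    and "open \<Omega>"
    and "locally_uniformly_continuous_on \<Omega> f"
    and "\<forall>x\<in>\<Omega>. f x \<ge> 0"
    and "u \<in> Lip_loc \<Omega>"
  shows "(monge_supersolution \<Omega> f u \<longleftrightarrow> s_supersolution \<Omega> f u) \<and>
         ((\<forall>x\<in>\<Omega>. f x > 0) \<longrightarrow> local_c_supersolution \<Omega> f u \<longrightarrow> monge_supersolution \<Omega> f u)"
  using monge_imp_s_supersolution[OF assms(1)] s_imp_monge_supersolution[OF assms(2,5)]
    c_imp_monge_supersolution[OF locally_uniformly_continuous_on_imp_isCont[OF assms(3)] assms(5)]
  by blast

end
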